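(* The class of eventually dendric shift spaces is closed under conjugacy: if $X$ is an eventually dendric shift space and $Y$ is a shift space conjugate to $X$, then $Y$ is eventually dendric.
   Context: A shift space over a finite alphabet $A$ is a closed subset $X\subseteq A^{\mathbb Z}$ with $\sigma(X)=X$, $\sigma$ the shift; $\mathcal L(X)$ is its set of finite factors. A sliding block code $\phi:X\to Y$ (with $Y\subseteq B^{\mathbb Z}$) is a map for which there exist $m,n\ge0$ and $f:\mathcal L_{m+n+1}(X)\to B$ with $\phi(x)_i=f(x_{i-m}\cdots x_{i+n})$ for all $i\in\mathbb Z$; $X$ and $Y$ are conjugate if there is a bijective sliding block code $X\to Y$. For $w\in\mathcal L(X)$ the extension graph $\mathcal E_1(w)$ is the undirected bipartite graph with vertex set the disjoint union of $\{a\in A: aw\in\mathcal L(X)\}$ and $\{b\in A: wb\in\mathcal L(X)\}$ and an edge $(a,b)$ iff $awb\in\mathcal L(X)$. $X$ is eventually dendric if for some $m\ge0$, $\mathcal E_1(w)$ is a tree for every $w\in\mathcal L(X)$ of length $\ge m$. *)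

theory Defs
  imports "HOL-Analysis.Analysis"
begin

text \<open>Points of the full shift are maps int => alphabet. The topology on A^Z is the
product of discrete topologies on the finite alphabet A.\<close>

definition shift :: "(int \<Rightarrow> 'a) \<Rightarrow> (int \<Rightarrow> 'a)" where
  "shift x = (\<lambda>i. x (i + 1))"

definition shift_space :: "'a set \<Rightarrow> (int \<Rightarrow> 'a) set \<Rightarrow> bool" where
  "shift_space A X \<longleftrightarrow> finite A
     \<and> closedin (product_topology (\<lambda>_::int. discrete_topology A) UNIV) X
     \<and> shift ` X = X"

text \<open>The word x_i x_{i+1} ... x_{i+n-1}.\<close>
definition window :: "(int \<Rightarrow> 'a) \<Rightarrow> int \<Rightarrow> nat \<Rightarrow> 'a list" where
  "window x i n = map (\<lambda>k. x (i + int k)) [0..<n]"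

text \<open>Language (set of finite factors) of X.\<close>
definition lang :: "(int \<Rightarrow> 'a) set \<Rightarrow> 'a list set" where
  "lang X = {w. \<exists>x\<in>X. \<exists>i. w = window x i (length w)}"

definition sliding_block_code ::
  "(int \<Rightarrow> 'a) set \<Rightarrow> (int \<Rightarrow> 'b) set \<Rightarrow> ((int \<Rightarrow> 'a) \<Rightarrow> (int \<Rightarrow> 'b)) \<Rightarrow> bool" where
  "sliding_block_code X Y \<phi> \<longleftrightarrow> \<phi> ` X \<subseteq> Y \<and>
     (\<exists>(m::nat) (n::nat) (f :: 'a list \<Rightarrow> 'b).
        \<forall>x\<in>X. \<forall>i. \<phi> x i = f (window x (i - int m) (m + n + 1)))"

definition conjugate :: "(int \<Rightarrow> 'a) set \<Rightarrow> (int \<Rightarrow> 'b) set \<Rightarrow> bool" where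
  "conjugate X Y \<longleftrightarrow> (\<exists>\<phi>. sliding_block_code X Y \<phi> \<and> bij_betw \<phi> X Y)"

text \<open>Extension graph E_1(w): bipartite, left vertices Inl a (a w in L(X)),
right vertices Inr b (w b in L(X)), undirected edge between Inl a and Inr b iff a w b in L(X).\<close>
definition ext_vertices :: "(int \<Rightarrow> 'a) set \<Rightarrow> 'a list \<Rightarrow> ('a + 'a) set" where
  "ext_vertices X w = Inl ` {a. a # w \<in> lang X} \<union> Inr ` {b. w @ [b] \<in> lang X}"

definition ext_adj :: "(int \<Rightarrow> 'a) set \<Rightarrow> 'a list \<Rightarrow> ('a + 'a) \<Rightarrow> ('a + 'a) \<Rightarrow> bool" where
  "ext_adj X w u v \<longleftrightarrow>
     (\<exists>a b. a # w @ [b] \<in> lang X \<and> ((u = Inl a \<and> v = Inr b) \<or> (u = Inr b \<and> v = Inl a)))"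

text \<open>An undirected graph (V, adj) is a tree: nonempty, connected, and without cycles
(a cycle = at least 3 distinct vertices, cyclically consecutive ones adjacent).\<close>
definition is_tree :: "'v set \<Rightarrow> ('v \<Rightarrow> 'v \<Rightarrow> bool) \<Rightarrow> bool" where
  "is_tree V adj \<longleftrightarrow> V \<noteq> {}
     \<and> (\<forall>u\<in>V. \<forall>v\<in>V. (u, v) \<in> {(x, y). x \<in> V \<and> y \<in> V \<and> adj x y}\<^sup>*)
     \<and> \<not> (\<exists>cs. length cs \<ge> 3 \<and> distinct cs \<and> set cs \<subseteq> V \<and>
            (\<forall>i < length cs. adj (cs ! i) (cs ! ((i + 1) mod length cs))))"

definition eventually_dendric :: "(int \<Rightarrow> 'a) set \<Rightarrow> bool" where
  "eventually_dendric X \<longleftrightarrow>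
     (\<exists>m. \<forall>w \<in> lang X. length w \<ge> m \<longrightarrow> is_tree (ext_vertices X w) (ext_adj X w))"

end

theory Submission
  imports Defs
begin

text \<open>
  Let \<open>X\<close> be eventually dendric. Acyclicity of the extension graphs makes the complexity eventually
  concave, hence eventually affine; with connectedness, it follows by counting that for every \<open>K\<close>,
  each long word that has several right extensions of length \<open>K\<close> has exactly one left extension
  with the same property, and that one keeps all right extensions. Combined with the mirror image
  of this statement, the graph of extensions by words of length \<open>K\<close> of a long word is a double
  star: some edge meets all the others. This property, for all \<open>K\<close>, passes through a conjugacy,
  since the extension graph of a long word of \<open>Y\<close> is an image of an induced subgraph of such a
  graph of \<open>X\<close>; and a double star is a tree.
\<close>

section \<open>Trees\<close>

definition cycle_in :: "'v set \<Rightarrow> ('v \<Rightarrow> 'v \<Rightarrow> bool) \<Rightarrow> 'v list \<Rightarrow> bool" where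
  "cycle_in V adj cs \<longleftrightarrow> length cs \<ge> 3 \<and> distinct cs \<and> set cs \<subseteq> V \<and>
     (\<forall>i < length cs. adj (cs ! i) (cs ! ((i + 1) mod length cs)))"

lemma cycle_in_mono: "cycle_in U adj cs \<Longrightarrow> U \<subseteq> V \<Longrightarrow> cycle_in V adj cs"
  by (auto simp: cycle_in_def)

text \<open>This excludes vertices with a single neighbour from cycles. The cyclic predecessor and
  successor differ because a cycle has at least three vertices.\<close>

lemma cycle_in_two_neighbours:
  assumes "cycle_in V adj cs" "c \<in> set cs" and sym: "\<And>u v. adj u v \<Longrightarrow> adj v u"
  obtains d e where "d \<noteq> e" "adj c d" "adj c e"
proof -
  let ?l = "length cs"
  from assms obtain i where i: "i < ?l" "c = cs ! i"
    by (metis in_set_conv_nth)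
  have l: "?l \<ge> 3" and dist: "distinct cs"
    and adj: "\<And>i. i < ?l \<Longrightarrow> adj (cs ! i) (cs ! ((i + 1) mod ?l))"
    using assms(1) by (auto simp: cycle_in_def)
  define j where "j = (if i = 0 then ?l - 1 else i - 1)"
  define k where "k = (if i + 1 = ?l then 0 else i + 1)"
  have j: "j < ?l" "(j + 1) mod ?l = i" using i l by (auto simp: j_def)
  have k: "k < ?l" "(i + 1) mod ?l = k" using i l by (auto simp: k_def)
  have "j \<noteq> k" using i l by (auto simp: j_def k_def split: if_splits)
  with dist j k have "cs ! j \<noteq> cs ! k" by (simp add: nth_eq_iff_index_eq)
  moreover have "adj c (cs ! k)" using adj[OF i(1)] k i by simp
  moreover have "adj c (cs ! j)" using adj[OF j(1)] j i sym by simp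
  ultimately show thesis using that by metis
qed

text \<open>The first vertex of a longest path is a leaf: by maximality all its neighbours lie on
  the path, and a neighbour other than the second vertex would close a cycle.\<close>

lemma acyclic_has_leaf:
  assumes "finite V" "V \<noteq> {}" and sym: "\<And>u v. adj u v \<Longrightarrow> adj v u"
    and irr: "\<And>u. \<not> adj u u" and acyc: "\<nexists>cs. cycle_in V adj cs"
  obtains v where "v \<in> V" "card {u \<in> V. adj v u} \<le> 1"
proof (rule ccontr)
  assume contr: "\<not> thesis"
  define P where "P = {cs. distinct cs \<and> set cs \<subseteq> V \<and> cs \<noteq> [] \<and>
     (\<forall>i. Suc i < length cs \<longrightarrow> adj (cs ! i) (cs ! Suc i))}"
  have "P \<subseteq> {cs. set cs \<subseteq> V \<and> length cs \<le> card V}"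
    using \<open>finite V\<close> by (auto simp: P_def) (metis card_mono distinct_card)
  then have "finite (length ` P)"
    using finite_lists_length_le[OF \<open>finite V\<close>] finite_subset by blast
  moreover obtain v0 where "v0 \<in> V" using \<open>V \<noteq> {}\<close> by blast
  then have "[v0] \<in> P" by (simp add: P_def)
  ultimately have "Max (length ` P) \<in> length ` P" by (intro Max_in) auto
  then obtain cs where cs: "cs \<in> P" and len: "length cs = Max (length ` P)" by auto
  have mx: "length ds \<le> length cs" if "ds \<in> P" for ds
    using that len \<open>finite (length ` P)\<close> by simp
  let ?c = "cs ! 0"
  have cV: "?c \<in> V" and c_in: "?c \<in> set cs" using cs by (auto simp: P_def)
  have "\<not> card {u \<in> V. adj ?c u} \<le> 1" using contr that cV by blast
  have nb: "u \<in> set cs" if "u \<in> V" "adj ?c u" for u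
  proof (rule ccontr)
    assume "u \<notin> set cs"
    have "u # cs \<in> P"
      using cs that sym \<open>u \<notin> set cs\<close> unfolding P_def
      by (auto simp: nth_Cons split: nat.splits)
    from mx[OF this] show False by simp
  qed
  \<comment> \<open>If the path has only one vertex, \<open>cs ! 1\<close> is an unspecified value;
    the argument only uses a neighbour different from it.\<close>
  have "\<not> {u \<in> V. adj ?c u} \<subseteq> {cs ! 1}"
    using \<open>\<not> card _ \<le> 1\<close> card_mono[of "{cs ! 1}" "{u \<in> V. adj ?c u}"] by auto
  then obtain u where u: "u \<in> V" "adj ?c u" "u \<noteq> cs ! 1" by blast
  then obtain j where j: "j < length cs" "u = cs ! j" using nb by (metis in_set_conv_nth)
  have "j \<noteq> 0" using u j irr[of ?c] by metis
  moreover have "j \<noteq> 1" using u j by auto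
  ultimately have j2: "j \<ge> 2" by simp
  have "cycle_in V adj (take (Suc j) cs)"
    unfolding cycle_in_def
  proof (intro conjI allI impI)
    show "3 \<le> length (take (Suc j) cs)" using j j2 by simp
    show "distinct (take (Suc j) cs)" "set (take (Suc j) cs) \<subseteq> V"
      using cs set_take_subset by (fastforce simp: P_def)+
    fix i assume i: "i < length (take (Suc j) cs)"
    show "adj (take (Suc j) cs ! i) (take (Suc j) cs ! ((i + 1) mod length (take (Suc j) cs)))"
    proof (cases "i = j")
      case True
      have "length (take (Suc j) cs) = Suc j" using j by simp
      then show ?thesis using True sym[OF u(2)] j(2) by simp
    next
      case False
      then show ?thesis using i j cs by (auto simp: P_def min_def)
    qed
  qed
  with acyc show False by blast
qed

text \<open>Removing a leaf removes at most one edge, so induction bounds the number of edges by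
  \<open>card V - 1\<close>. Everything is doubled, since each edge appears as two ordered
  pairs.\<close>

lemma acyclic_card_edges:
  assumes "finite V" "V \<noteq> {}" and sym: "\<And>u v. adj u v \<Longrightarrow> adj v u"
    and irr: "\<And>u. \<not> adj u u" and acyc: "\<nexists>cs. cycle_in V adj cs"
  shows "card {(u, v). u \<in> V \<and> v \<in> V \<and> adj u v} + 2 \<le> 2 * card V"
  using assms(1,2,5)
proof (induction "card V" arbitrary: V rule: less_induct)
  case less
  obtain v where v: "v \<in> V" "card {u \<in> V. adj v u} \<le> 1"
    using acyclic_has_leaf[OF less.prems(1,2) sym irr less.prems(3)] by blast
  let ?E = "\<lambda>V. {(u, v). u \<in> V \<and> v \<in> V \<and> adj u v}"
  let ?W = "V - {v}" and ?N = "{u \<in> V. adj v u}"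
  have finE: "finite (?E U)" if "finite U" for U
    by (rule finite_subset[of _ "U \<times> U"]) (use that in auto)
  have sub: "?E V \<subseteq> ?E ?W \<union> (Pair v ` ?N \<union> (\<lambda>u. (u, v)) ` ?N)"
    using sym by auto
  have "card (Pair v ` ?N \<union> (\<lambda>u. (u, v)) ` ?N) \<le> card ?N + card ?N"
    using less.prems(1)
    by (intro order_trans[OF card_Un_le] add_mono card_image_le) auto
  moreover have "card (?E V) \<le> card (?E ?W \<union> (Pair v ` ?N \<union> (\<lambda>u. (u, v)) ` ?N))"
    by (rule card_mono[OF _ sub]) (use finE[of ?W] less.prems(1) in simp)
  ultimately have *: "card (?E V) \<le> card (?E ?W) + 2 * card ?N"
    using card_Un_le[of "?E ?W" "Pair v ` ?N \<union> (\<lambda>u. (u, v)) ` ?N"] by linarith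
  show ?case
  proof (cases "?W = {}")
    case True
    then have V: "V = {v}" using v by blast
    then have "?E V = {}" using irr by auto
    then have "card (?E V) = 0" by (simp only: card.empty)
    with V show ?thesis by simp
  next
    case False
    have cW: "card ?W + 1 = card V" using v(1) less.prems(1)
      by (metis Suc_eq_plus1 card_Suc_Diff1)
    have "card (?E ?W) + 2 \<le> 2 * card ?W"
      using less.hyps[of ?W] cW False less.prems(1,3) cycle_in_mono[of ?W adj _ V] by auto
    with * cW v(2) show ?thesis by linarith
  qed
qed

lemma rtrancl_crosses_boundary:
  assumes "(u, v) \<in> R\<^sup>*" "u \<in> S" "v \<notin> S"
  shows "\<exists>x y. (x, y) \<in> R \<and> x \<in> S \<and> y \<notin> S"
  using assms by (induction rule: rtrancl_induct) blast+

section \<open>Extension graphs of a language\<close>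

text \<open>In an extendable language every one-sided extension of length \<open>K\<close> is an
  endpoint of some edge, so the edge set determines the graph.\<close>

definition biext :: "'a list set \<Rightarrow> nat \<Rightarrow> 'a list \<Rightarrow> ('a list \<times> 'a list) set" where
  "biext L K w = {(u, z). length u = K \<and> length z = K \<and> u @ w @ z \<in> L}"

definition double_star :: "('l \<times> 'r) set \<Rightarrow> bool" where
  "double_star E \<longleftrightarrow> (\<exists>(a, b) \<in> E. \<forall>(c, d) \<in> E. c = a \<or> d = b)"

text \<open>These properties are separated from the points of the shift because they are invariant
  under reversal (\<open>mirror\<close>); results on right extensions then yield results on left
  extensions.\<close>

locale extendable_language =
  fixes A :: "'a set" and L :: "'a list set"
  assumes finite_alphabet: "finite A"
    and letters: "w \<in> L \<Longrightarrow> set w \<subseteq> A"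
    and factorial: "u @ w @ v \<in> L \<Longrightarrow> w \<in> L"
    and extend_right: "w \<in> L \<Longrightarrow> \<exists>b. w @ [b] \<in> L"
    and extend_left: "w \<in> L \<Longrightarrow> \<exists>a. a # w \<in> L"
begin

lemma suffix_closed: "u @ w \<in> L \<Longrightarrow> w \<in> L"
  using factorial[of u w "[]"] by simp

lemma prefix_closed: "w @ v \<in> L \<Longrightarrow> w \<in> L"
  using factorial[of "[]" w v] by simp

lemma tail_closed: "a # w \<in> L \<Longrightarrow> w \<in> L"
  using suffix_closed[of "[a]" w] by simp

lemma mirror: "extendable_language A (rev ` L)"
proof
  show "finite A" by (rule finite_alphabet)
  show "set w \<subseteq> A" if "w \<in> rev ` L" for w
    using that letters by fastforce
  show "w \<in> rev ` L" if "u @ w @ v \<in> rev ` L" for u w v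
  proof -
    from that have "rev v @ rev w @ rev u \<in> L"
      by (metis (no_types, lifting) append.assoc imageE rev_append rev_rev_ident)
    then show ?thesis by (metis factorial image_eqI rev_rev_ident)
  qed
  show "\<exists>b. w @ [b] \<in> rev ` L" if "w \<in> rev ` L" for w
    using that extend_left by (metis (no_types, opaque_lifting) imageE image_eqI rev.simps(2))
  show "\<exists>a. a # w \<in> rev ` L" if "w \<in> rev ` L" for w
    using that extend_right
    by (metis (no_types, opaque_lifting) imageE image_eqI rev_eq_Cons_iff rev_rev_ident)
qed

lemma extend_right_by: "w \<in> L \<Longrightarrow> \<exists>z. length z = K \<and> w @ z \<in> L"
proof (induction K)
  case (Suc K)
  then obtain z where "length z = K" "w @ z \<in> L" by blast
  moreover from this obtain b where "(w @ z) @ [b] \<in> L" using extend_right by blast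
  ultimately show ?case by (intro exI[of _ "z @ [b]"]) simp
qed simp

lemma extend_left_by: "w \<in> L \<Longrightarrow> \<exists>u. length u = K \<and> u @ w \<in> L"
proof (induction K)
  case (Suc K)
  then obtain u where "length u = K" "u @ w \<in> L" by blast
  moreover from this obtain a where "a # u @ w \<in> L" using extend_left by blast
  ultimately show ?case by (intro exI[of _ "a # u"]) simp
qed simp

section \<open>Counting words and right special words\<close>

definition words :: "nat \<Rightarrow> 'a list set" where
  "words n = {w \<in> L. length w = n}"

definition right_exts :: "nat \<Rightarrow> 'a list \<Rightarrow> 'a list set" where
  "right_exts K w = {z. length z = K \<and> w @ z \<in> L}"

text \<open>For \<open>K = 1\<close> these are the usual right special words; for larger
  \<open>K\<close> the branching may come after further common letters.\<close>

definition right_special :: "nat \<Rightarrow> nat \<Rightarrow> 'a list set" where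
  "right_special K n = {w \<in> words n. card (right_exts K w) \<ge> 2}"

lemma finite_length: "finite {w. length w = n \<and> set w \<subseteq> A}"
  using finite_lists_length_eq[OF finite_alphabet, of n] by (simp add: conj_commute)

lemma finite_words: "finite (words n)"
  by (rule finite_subset[OF _ finite_length[of n]]) (use letters in \<open>auto simp: words_def\<close>)

lemma finite_right_exts: "finite (right_exts K w)"
  by (rule finite_subset[OF _ finite_length[of K]])
    (use letters[of "w @ _"] in \<open>auto simp: right_exts_def\<close>)

lemma finite_right_special: "finite (right_special K n)"
  using finite_words[of n] by (auto simp: right_special_def)

lemma right_exts_suffix: "right_exts K (u @ w) \<subseteq> right_exts K w"
  using suffix_closed[of u] by (auto simp: right_exts_def)

lemma card_right_exts_pos: "w \<in> L \<Longrightarrow> card (right_exts K w) \<ge> 1"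
  using extend_right_by[of w K] finite_right_exts[of K w]
  by (metis (mono_tags, lifting) One_nat_def Suc_leI card_gt_0_iff empty_iff mem_Collect_eq
      right_exts_def)

lemma right_special_iff:
  "w \<in> right_special K n \<longleftrightarrow> length w = n \<and>
     (\<exists>y z. y \<noteq> z \<and> length y = K \<and> length z = K \<and> w @ y \<in> L \<and> w @ z \<in> L)"
proof -
  have "card (right_exts K w) \<ge> 2 \<longleftrightarrow> (\<exists>y\<in>right_exts K w. \<exists>z\<in>right_exts K w. y \<noteq> z)"
    using card_le_Suc0_iff_eq[OF finite_right_exts[of K w]]
    by (auto simp: numeral_2_eq_2 not_less_eq_eq[symmetric])
  moreover have "w \<in> L" if "w @ y \<in> L" for y using that by (rule prefix_closed)
  ultimately show ?thesis
    unfolding right_special_def words_def right_exts_def by blast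
qed

lemma card_words_add: "card (words (n + K)) = (\<Sum>w\<in>words n. card (right_exts K w))"
proof -
  have "bij_betw (\<lambda>(w, z). w @ z) (Sigma (words n) (right_exts K)) (words (n + K))"
  proof (rule bij_betwI[where g = "\<lambda>v. (take n v, drop n v)"])
    show "(\<lambda>v. (take n v, drop n v)) \<in> words (n + K) \<rightarrow> Sigma (words n) (right_exts K)"
      using prefix_closed by (auto simp: words_def right_exts_def) (metis append_take_drop_id)
  qed (auto simp: words_def right_exts_def)
  then show ?thesis
    by (simp add: bij_betw_same_card[symmetric] finite_words finite_right_exts)
qed

lemma card_words_Suc_left: "card (words (Suc n)) = (\<Sum>w\<in>words n. card {a. a # w \<in> L})"
proof -
  have fin: "finite {a. a # w \<in> L}" for w
    by (rule finite_subset[OF _ finite_alphabet]) (use letters in force)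
  have "bij_betw (\<lambda>(w, a). a # w) (Sigma (words n) (\<lambda>w. {a. a # w \<in> L})) (words (Suc n))"
    by (rule bij_betwI[where g = "\<lambda>v. (tl v, hd v)"])
      (auto simp: words_def length_Suc_conv dest: tail_closed)
  then show ?thesis
    by (simp add: bij_betw_same_card[symmetric] finite_words fin)
qed

lemma card_words_Suc_right: "card (words (Suc n)) = (\<Sum>w\<in>words n. card {b. w @ [b] \<in> L})"
proof -
  have "right_exts 1 w = (\<lambda>b. [b]) ` {b. w @ [b] \<in> L}" for w
    by (auto simp: right_exts_def length_Suc_conv)
  then have "card (right_exts 1 w) = card {b. w @ [b] \<in> L}" for w
    by (simp add: card_image inj_on_def)
  then show ?thesis using card_words_add[of n 1] by simp
qed

lemma card_words_Suc_Suc: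
  "card (words (n + 2)) = (\<Sum>w\<in>words n. card {(a, b). a # w @ [b] \<in> L})"
proof -
  have fin: "finite {(a, b). a # w @ [b] \<in> L}" for w
    by (rule finite_subset[of _ "A \<times> A"]) (use letters finite_alphabet in force)+
  have "bij_betw (\<lambda>(w, a, b). a # w @ [b])
      (Sigma (words n) (\<lambda>w. {(a, b). a # w @ [b] \<in> L})) (words (n + 2))"
  proof (rule bij_betwI[where g = "\<lambda>v. (butlast (tl v), hd v, last v)"])
    show "(\<lambda>v. (butlast (tl v), hd v, last v)) \<in>
        words (n + 2) \<rightarrow> Sigma (words n) (\<lambda>w. {(a, b). a # w @ [b] \<in> L})"
    proof
      fix v assume v: "v \<in> words (n + 2)"
      then obtain a u where au: "v = a # u" "length u = n + 1"
        by (auto simp: words_def length_Suc_conv)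
      then obtain w b where "u = w @ [b]" "length w = n"
        by (metis Suc_eq_plus1 length_Suc_conv_rev)
      with au v factorial[of "[a]" w "[b]"]
      show "(butlast (tl v), hd v, last v) \<in> Sigma (words n) (\<lambda>w. {(a, b). a # w @ [b] \<in> L})"
        by (auto simp: words_def)
    qed
    show "(\<lambda>(w, a, b). a # w @ [b]) ((butlast (tl v), hd v, last v)) = v"
      if "v \<in> words (n + 2)" for v
    proof -
      have "v \<noteq> []" "tl v \<noteq> []" using that by (cases v; auto simp: words_def)+
      then show ?thesis by simp (metis append_butlast_last_id last_tl list.collapse)
    qed
  qed (auto simp: words_def)
  then show ?thesis
    by (simp add: bij_betw_same_card[symmetric] finite_words fin)
qed

end


section \<open>Dendric languages: growth and special words\<close>

lemma incseq_bounded_eventually_const: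
  fixes f :: "nat \<Rightarrow> nat"
  assumes inc: "\<And>n. n \<ge> m \<Longrightarrow> f n \<le> f (Suc n)" and bd: "\<And>n. n \<ge> m \<Longrightarrow> f n \<le> B"
  shows "\<exists>N\<ge>m. \<forall>n\<ge>N. f n = f N"
proof -
  obtain N where N: "N \<ge> m" "\<And>n. n \<ge> m \<Longrightarrow> f n \<le> f N"
    using ex_has_greatest_nat[of "\<lambda>n. n \<ge> m" m f "Suc B"] bd by (auto simp: less_Suc_eq_le)
  have "f N \<le> f n" if "n \<ge> N" for n
    using that by (induction n rule: dec_induct) (use N(1) inc in \<open>auto intro: le_trans\<close>)
  with N show ?thesis by (metis le_antisym le_trans)
qed

text \<open>What is needed of tree-like extension graphs: acyclicity bounds the number of edges, and
  connectedness makes special words extend to special words.\<close>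

locale dendric_language = extendable_language +
  fixes m :: nat
  assumes edges_le: "w \<in> L \<Longrightarrow> length w \<ge> m \<Longrightarrow>
      card {(a, b). a # w @ [b] \<in> L} + 1 \<le> card {a. a # w \<in> L} + card {b. w @ [b] \<in> L}"
    and right_special_extends: "w \<in> L \<Longrightarrow> length w \<ge> m \<Longrightarrow> b \<noteq> b' \<Longrightarrow>
      w @ [b] \<in> L \<Longrightarrow> w @ [b'] \<in> L \<Longrightarrow> \<exists>a c c'. c \<noteq> c' \<and> a # w @ [c] \<in> L \<and> a # w @ [c'] \<in> L"
    and left_special_extends: "w \<in> L \<Longrightarrow> length w \<ge> m \<Longrightarrow> a \<noteq> a' \<Longrightarrow>
      a # w \<in> L \<Longrightarrow> a' # w \<in> L \<Longrightarrow> \<exists>b c c'. c \<noteq> c' \<and> c # w @ [b] \<in> L \<and> c' # w @ [b] \<in> L"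
begin

lemma mirror_dendric: "dendric_language A (rev ` L) m"
proof -
  interpret M: extendable_language A "rev ` L" by (rule mirror)
  have mem: "w \<in> rev ` L \<longleftrightarrow> rev w \<in> L" for w
    by (metis imageE image_eqI rev_rev_ident)
  show ?thesis
  proof
    fix w assume "w \<in> rev ` L" "length w \<ge> m"
    then have w: "rev w \<in> L" "length (rev w) \<ge> m" by (simp_all add: mem)
    have "{(a, b). a # w @ [b] \<in> rev ` L} = prod.swap ` {(a, b). a # rev w @ [b] \<in> L}"
      by (auto simp: mem)
    then have "card {(a, b). a # w @ [b] \<in> rev ` L} = card {(a, b). a # rev w @ [b] \<in> L}"
      by (simp add: card_image)
    then show "card {(a, b). a # w @ [b] \<in> rev ` L} + 1
        \<le> card {a. a # w \<in> rev ` L} + card {b. w @ [b] \<in> rev ` L}"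
      using edges_le[OF w] by (simp add: mem)
    show "\<exists>a c c'. c \<noteq> c' \<and> a # w @ [c] \<in> rev ` L \<and> a # w @ [c'] \<in> rev ` L"
      if "b \<noteq> b'" "w @ [b] \<in> rev ` L" "w @ [b'] \<in> rev ` L" for b b'
      using left_special_extends[OF w that(1)] that by (simp add: mem)
    show "\<exists>b c c'. c \<noteq> c' \<and> c # w @ [b] \<in> rev ` L \<and> c' # w @ [b] \<in> rev ` L"
      if "a \<noteq> a'" "a # w \<in> rev ` L" "a' # w \<in> rev ` L" for a a'
      using right_special_extends[OF w that(1)] that by (simp add: mem)
  qed
qed

text \<open>Sum \<open>edges_le\<close> over all words of length \<open>n\<close>: edges count words
  of length \<open>n + 2\<close>, the vertices on each side count words of length
  \<open>n + 1\<close>, and the summand 1 counts words of length \<open>n\<close>.\<close>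

lemma card_words_concave:
  assumes "n \<ge> m"
  shows "card (words (n + 2)) + card (words n) \<le> 2 * card (words (Suc n))"
proof -
  have "(\<Sum>w\<in>words n. card {(a, b). a # w @ [b] \<in> L} + 1)
      \<le> (\<Sum>w\<in>words n. card {a. a # w \<in> L} + card {b. w @ [b] \<in> L})"
    by (rule sum_mono) (use assms edges_le in \<open>auto simp: words_def\<close>)
  then show ?thesis
    unfolding sum.distrib card_words_Suc_Suc[symmetric]
      card_words_Suc_left[symmetric] card_words_Suc_right[symmetric] by simp
qed

text \<open>By concavity the increments are non-increasing natural numbers from \<open>m\<close> on,
  hence eventually constant.\<close>

lemma card_words_eventually_affine:
  obtains N d where "N \<ge> m" "\<And>n k. n \<ge> N \<Longrightarrow> card (words (n + k)) = card (words n) + k * d"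
proof -
  have mono: "card (words n) \<le> card (words (Suc n))" for n
  proof -
    have "(\<Sum>w\<in>words n. 1) \<le> (\<Sum>w\<in>words n. card (right_exts 1 w))"
      by (rule sum_mono) (use card_right_exts_pos in \<open>auto simp: words_def\<close>)
    then show ?thesis by (simp add: card_words_add[symmetric])
  qed
  define \<delta> where "\<delta> n = card (words (Suc n)) - card (words n)" for n
  have dec: "\<delta> (Suc n) \<le> \<delta> n" if "n \<ge> m" for n
    using card_words_concave[OF that] mono[of n] mono[of "Suc n"] by (simp add: \<delta>_def)
  have le: "\<delta> n \<le> \<delta> m" if "n \<ge> m" for n
    using that by (induction n rule: dec_induct) (use dec in \<open>auto intro: le_trans\<close>)
  \<comment> \<open>The lemma on bounded increasing sequences is applied to the total drop of the
    increment; since \<open>\<delta> n \<le> \<delta> m\<close>, the truncated subtraction loses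
    nothing.\<close>
  have "\<exists>N\<ge>m. \<forall>n\<ge>N. \<delta> m - \<delta> n = \<delta> m - \<delta> N"
    by (rule incseq_bounded_eventually_const[where B = "\<delta> m"]) (simp_all add: dec diff_le_mono2)
  then obtain N where N: "N \<ge> m" "\<And>n. n \<ge> N \<Longrightarrow> \<delta> m - \<delta> n = \<delta> m - \<delta> N" by blast
  have const: "\<delta> n = \<delta> N" if "n \<ge> N" for n
    using N(2)[OF that] le[of n] le[of N] N(1) that by linarith
  have "card (words (n + k)) = card (words n) + k * \<delta> N" if "n \<ge> N" for n k
  proof (induction k)
    case (Suc k)
    have "card (words (Suc (n + k))) = card (words (n + k)) + \<delta> N"
      using const[of "n + k"] mono[of "n + k"] that by (simp add: \<delta>_def)
    with Suc show ?case by simp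
  qed simp
  with N(1) that show thesis by blast
qed

text \<open>Two extensions of \<open>w\<close> diverge after a common prefix \<open>q\<close>, so
  \<open>w @ q\<close> is right special for single letters. A letter \<open>a\<close> in front that
  preserves two continuations of \<open>w @ q\<close> makes \<open>a # w\<close> right
  special.\<close>

lemma right_special_Suc:
  assumes "w \<in> right_special K n" "n \<ge> m"
  shows "\<exists>a. a # w \<in> right_special K (Suc n)"
proof -
  from assms(1) obtain y z where yz: "y \<noteq> z" "length y = K" "length z = K"
    and L: "w @ y \<in> L" "w @ z \<in> L" and n: "length w = n"
    by (auto simp: right_special_iff)
  obtain q s t where q: "y = q @ s" "z = q @ t" and st: "s = [] \<or> t = [] \<or> hd s \<noteq> hd t"
    using longest_common_prefix by metis
  have ne: "s \<noteq> []" "t \<noteq> []" using q yz by auto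
  then have y: "y = q @ [hd s] @ tl s" and z: "z = q @ [hd t] @ tl t" by (simp_all add: q)
  have "(w @ q) @ [hd s] \<in> L" "(w @ q) @ [hd t] \<in> L"
    using L prefix_closed[of "(w @ q) @ [hd s]" "tl s"] prefix_closed[of "(w @ q) @ [hd t]" "tl t"]
    by (simp_all add: y z)
  moreover from this have "w @ q \<in> L" by (blast dest: prefix_closed)
  moreover have "length (w @ q) \<ge> m" using n assms(2) by simp
  moreover have "hd s \<noteq> hd t" using st ne by simp
  ultimately obtain a c c' where c: "c \<noteq> c'" "a # (w @ q) @ [c] \<in> L" "a # (w @ q) @ [c'] \<in> L"
    using right_special_extends[of "w @ q"] by blast
  \<comment> \<open>The letters \<open>c\<close>, \<open>c'\<close> may differ from
    \<open>hd s\<close>, \<open>hd t\<close>, so new tails are chosen, of the length that brings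
    both extensions back to \<open>K\<close>.\<close>
  from extend_right_by[OF c(2), of "length (tl s)"] obtain s'
    where s': "length s' = length (tl s)" "(a # (w @ q) @ [c]) @ s' \<in> L" by blast
  from extend_right_by[OF c(3), of "length (tl s)"] obtain t'
    where t': "length t' = length (tl s)" "(a # (w @ q) @ [c']) @ t' \<in> L" by blast
  have "length (q @ c # s') = K" "length (q @ c' # t') = K"
    using s' t' ne yz(2) q by (auto simp: neq_Nil_conv)
  moreover have "q @ c # s' \<noteq> q @ c' # t'" using c by simp
  ultimately have "a # w \<in> right_special K (Suc n)"
    unfolding right_special_iff using s'(2) t'(2) n
    by (intro conjI exI[of _ "q @ c # s'"] exI[of _ "q @ c' # t'"]) simp_all
  then show ?thesis ..
qed

lemma drop_right_special:
  assumes "v \<in> right_special K (n + J)"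
  shows "drop J v \<in> right_special K n"
proof -
  have "take J v @ drop J v @ y \<in> L" if "v @ y \<in> L" for y
    using that by (metis append.assoc append_take_drop_id)
  with assms suffix_closed show ?thesis
    unfolding right_special_iff by (metis add_diff_cancel_right' length_drop)
qed

text \<open>Deleting a prefix is thus a surjection between sets of right special words: their number
  cannot decrease with the length, and where it is constant the deletion is injective.\<close>

lemma drop_image_right_special:
  assumes "n \<ge> m"
  shows "drop J ` right_special K (n + J) = right_special K n"
proof
  show "drop J ` right_special K (n + J) \<subseteq> right_special K n"
    using drop_right_special by blast
  have "\<exists>u. length u = J \<and> u @ w \<in> right_special K (n + J)" if "w \<in> right_special K n" for w
  proof (induction J)
    case 0
    then show ?case using that by simp
  next
    case (Suc J)
    then obtain u where u: "length u = J" "u @ w \<in> right_special K (n + J)" by blast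
    then obtain a where "a # u @ w \<in> right_special K (Suc (n + J))"
      using right_special_Suc assms by fastforce
    with u(1) show ?case by (intro exI[of _ "a # u"]) simp
  qed
  then show "right_special K n \<subseteq> drop J ` right_special K (n + J)"
    by (metis append_eq_conv_conj image_eqI subsetI)
qed

text \<open>Each word of length \<open>n\<close> has one right extension plus its excess, and the
  excess vanishes unless the word is right special.\<close>

lemma sum_right_special:
  "(\<Sum>w\<in>right_special K n. card (right_exts K w) - 1) + card (words n) = card (words (n + K))"
proof -
  have "(\<Sum>w\<in>right_special K n. card (right_exts K w) - 1)
      = (\<Sum>w\<in>words n. card (right_exts K w) - 1)"
    by (rule sum.mono_neutral_left) (auto simp: finite_words right_special_def)
  moreover have "(\<Sum>w\<in>words n. card (right_exts K w) - 1) + (\<Sum>w\<in>words n. 1)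
      = (\<Sum>w\<in>words n. card (right_exts K w))"
    unfolding sum.distrib[symmetric]
    by (rule sum.cong) (use card_right_exts_pos[of _ K] in \<open>force simp: words_def\<close>)+
  ultimately show ?thesis by (simp add: card_words_add)
qed

text \<open>For long lengths both the number of right special words and the sum of their excesses
  \<open>card (right_exts K w) - 1\<close> are constant. So each right special word has exactly one right
  special left extension, and it keeps all right extensions.\<close>

lemma eventually_left_hub:
  obtains N where "\<And>w. w \<in> L \<Longrightarrow> length w \<ge> N \<Longrightarrow> \<exists>u. length u = K \<and> u @ w \<in> L \<and>
      (\<forall>z. length z = K \<longrightarrow> w @ z \<in> L \<longrightarrow> u @ w @ z \<in> L) \<and>
      (\<forall>(t, y) \<in> biext L K w. \<forall>(t', z) \<in> biext L K w. t = t' \<longrightarrow> t = u \<or> y = z)"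
proof -
  obtain N0 d where N0: "N0 \<ge> m"
    and aff: "\<And>n k. n \<ge> N0 \<Longrightarrow> card (words (n + k)) = card (words n) + k * d"
    using card_words_eventually_affine by metis
  have excess: "(\<Sum>w\<in>right_special K n. card (right_exts K w) - 1) = K * d" if "n \<ge> N0" for n
    using sum_right_special[of K n] aff[OF that, of K] by simp
  \<comment> \<open>Every right special word has excess at least 1.\<close>
  have bound: "card (right_special K n) \<le> K * d" if "n \<ge> N0" for n
  proof -
    have "(\<Sum>w\<in>right_special K n. 1) \<le> (\<Sum>w\<in>right_special K n. card (right_exts K w) - 1)"
      by (rule sum_mono) (auto simp: right_special_def)
    with excess[OF that] show ?thesis by simp
  qed
  have inc: "card (right_special K n) \<le> card (right_special K (Suc n))" if "n \<ge> N0" for n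
    using surj_card_le[OF finite_right_special] drop_image_right_special[of n 1 K] that N0
    by (metis Suc_eq_plus1 dual_order.trans equalityD1)
  have "\<exists>N\<ge>N0. \<forall>n\<ge>N. card (right_special K n) = card (right_special K N)"
    by (rule incseq_bounded_eventually_const) (fact inc bound)+
  then obtain N where N: "N \<ge> N0"
    and const: "\<And>n. n \<ge> N \<Longrightarrow> card (right_special K n) = card (right_special K N)" by blast
  show thesis
  proof (rule that[of N])
    fix w assume w: "w \<in> L" "length w \<ge> N"
    let ?n = "length w"
    let ?R = "right_special K (?n + K)"
    have n: "?n \<ge> m" "?n \<ge> N0" "?n \<ge> N" using w N N0 by auto
    show "\<exists>u. length u = K \<and> u @ w \<in> L \<and>
      (\<forall>z. length z = K \<longrightarrow> w @ z \<in> L \<longrightarrow> u @ w @ z \<in> L) \<and>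
      (\<forall>(t, y) \<in> biext L K w. \<forall>(t', z) \<in> biext L K w. t = t' \<longrightarrow> t = u \<or> y = z)"
    proof (cases "w \<in> right_special K ?n")
      case False
      then have uniq: "y = z" if "length y = K" "length z = K" "w @ y \<in> L" "w @ z \<in> L" for y z
        using that by (auto simp: right_special_iff)
      \<comment> \<open>With a unique right extension any \<open>u\<close> will do:
        \<open>u @ w\<close> has some right extension of length \<open>K\<close>, which must be that
        one.\<close>
      obtain u where u: "length u = K" "u @ w \<in> L" using extend_left_by w by blast
      then obtain z where z: "length z = K" "(u @ w) @ z \<in> L" using extend_right_by by blast
      moreover have "w @ z \<in> L" using suffix_closed[of u "w @ z"] z by simp
      ultimately have "\<forall>z. length z = K \<longrightarrow> w @ z \<in> L \<longrightarrow> u @ w @ z \<in> L"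
        using uniq by (metis append.assoc)
      moreover have "y = z" if "(t, y) \<in> biext L K w" "(t, z) \<in> biext L K w" for t y z
        using that uniq suffix_closed[of t] by (auto simp: biext_def)
      ultimately show ?thesis using u by blast
    next
      case True
      have inj: "inj_on (drop K) ?R"
        by (rule eq_card_imp_inj_on[OF finite_right_special])
          (use drop_image_right_special[OF n(1)] const[of ?n] const[of "?n + K"] n in simp)
      from True have "w \<in> drop K ` ?R" by (simp add: drop_image_right_special[OF n(1)])
      then obtain v where v: "v \<in> ?R" "drop K v = w" by auto
      define u where "u = take K v"
      have u: "length u = K" "v = u @ w"
        using v(1) append_take_drop_id[of K v] by (simp_all add: u_def v(2) right_special_iff)
      have sub: "right_exts K v \<subseteq> right_exts K (drop K v)" for v
        using right_exts_suffix[of K "take K v" "drop K v"] by simp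
      \<comment> \<open>The two total excesses agree, and deleting a prefix can only enlarge the set
        of right extensions; so equality holds term by term.\<close>
      have "(\<Sum>v\<in>?R. card (right_exts K v) - 1) = (\<Sum>v\<in>?R. card (right_exts K (drop K v)) - 1)"
        using excess[of ?n] excess[of "?n + K"] n
          sum.reindex[OF inj, of "\<lambda>w. card (right_exts K w) - 1"] drop_image_right_special[OF n(1)]
        by (simp add: o_def)
      then have "card (right_exts K v) - 1 = card (right_exts K (drop K v)) - 1"
        by (rule sum_mono_inv[OF _ _ v(1) finite_right_special])
          (use sub finite_right_exts in \<open>auto intro!: diff_le_mono card_mono\<close>)
      moreover have "v \<in> L" using v(1) by (auto simp: right_special_def words_def)
      ultimately have "card (right_exts K v) = card (right_exts K w)"
        using card_right_exts_pos[of v K] card_right_exts_pos[of w K] w(1) v(2) by simp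
      then have "right_exts K v = right_exts K w"
        using card_subset_eq[OF finite_right_exts sub[of v]] v(2) by simp
      then have "\<forall>z. length z = K \<longrightarrow> w @ z \<in> L \<longrightarrow> u @ w @ z \<in> L"
        by (auto simp: right_exts_def u(2))
      \<comment> \<open>Two right extensions make \<open>t @ w\<close> right special, and
        injectivity of \<open>drop K\<close> identifies it with \<open>v\<close>.\<close>
      moreover have "t = u"
        if "(t, y) \<in> biext L K w" "(t, z) \<in> biext L K w" "y \<noteq> z" for t y z
      proof -
        have "t @ w \<in> ?R" "drop K (t @ w) = w"
          using that unfolding right_special_iff biext_def by auto
        then have "t @ w = v" using inj_onD[OF inj] v by metis
        with u show ?thesis by simp
      qed
      ultimately show ?thesis using u \<open>v \<in> L\<close> by blast
    qed
  qed
qed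

text \<open>The left hub \<open>u\<close> meets all right extensions; the hub \<open>z\<close> from
  the reversed language meets all left extensions. For an edge \<open>(c, d)\<close> the pair
  \<open>(c, z)\<close> is also an edge, and only \<open>u\<close> has several neighbours, so
  \<open>c = u\<close> or \<open>d = z\<close>.\<close>

lemma eventually_double_star:
  obtains N where "\<And>w. w \<in> L \<Longrightarrow> length w \<ge> N \<Longrightarrow> double_star (biext L K w)"
proof -
  interpret M: dendric_language A "rev ` L" m by (rule mirror_dendric)
  have mem: "w \<in> rev ` L \<longleftrightarrow> rev w \<in> L" for w
    by (metis imageE image_eqI rev_rev_ident)
  obtain N1 where N1: "\<And>w. w \<in> L \<Longrightarrow> length w \<ge> N1 \<Longrightarrow> \<exists>u. length u = K \<and> u @ w \<in> L \<and>
      (\<forall>z. length z = K \<longrightarrow> w @ z \<in> L \<longrightarrow> u @ w @ z \<in> L) \<and>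
      (\<forall>(t, y) \<in> biext L K w. \<forall>(t', z) \<in> biext L K w. t = t' \<longrightarrow> t = u \<or> y = z)"
    using eventually_left_hub by blast
  obtain N2 where N2: "\<And>w. w \<in> rev ` L \<Longrightarrow> length w \<ge> N2 \<Longrightarrow>
      \<exists>u. length u = K \<and> u @ w \<in> rev ` L \<and>
      (\<forall>z. length z = K \<longrightarrow> w @ z \<in> rev ` L \<longrightarrow> u @ w @ z \<in> rev ` L) \<and>
      (\<forall>(t, y) \<in> biext (rev ` L) K w. \<forall>(t', z) \<in> biext (rev ` L) K w. t = t' \<longrightarrow> t = u \<or> y = z)"
    using M.eventually_left_hub by blast
  show thesis
  proof (rule that[of "max N1 N2"])
    fix w assume w: "w \<in> L" "length w \<ge> max N1 N2"
    obtain u where u: "length u = K" "\<And>z. length z = K \<Longrightarrow> w @ z \<in> L \<Longrightarrow> u @ w @ z \<in> L"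
      and u_only: "\<And>t y z. (t, y) \<in> biext L K w \<Longrightarrow> (t, z) \<in> biext L K w \<Longrightarrow> t = u \<or> y = z"
      using N1[of w] w by fastforce
    obtain z' where "length z' = K" "z' @ rev w \<in> rev ` L"
      and "\<forall>t. length t = K \<longrightarrow> rev w @ t \<in> rev ` L \<longrightarrow> z' @ rev w @ t \<in> rev ` L"
      using N2[of "rev w"] w by auto
    moreover define z where "z = rev z'"
    ultimately have z: "length z = K" "w @ z \<in> L"
      and z_all: "\<forall>t. length t = K \<longrightarrow> rev t @ w \<in> L \<longrightarrow> rev t @ w @ z \<in> L"
      by (simp_all add: mem)
    have "c = u \<or> d = z" if "(c, d) \<in> biext L K w" for c d
    proof -
      have "c @ w \<in> L" "length c = K"
        using that prefix_closed[of "c @ w" d] by (auto simp: biext_def)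
      with z_all have "c @ w @ z \<in> L" by (metis length_rev rev_rev_ident)
      with \<open>length c = K\<close> z(1) have "(c, z) \<in> biext L K w" by (simp add: biext_def)
      with u_only that show ?thesis by blast
    qed
    moreover have "(u, z) \<in> biext L K w" using u z by (simp add: biext_def)
    ultimately show "double_star (biext L K w)" unfolding double_star_def by blast
  qed
qed

end


section \<open>Shift spaces\<close>

lemma length_window [simp]: "length (window x i n) = n"
  by (simp add: window_def)

lemma nth_window [simp]: "k < n \<Longrightarrow> window x i n ! k = x (i + int k)"
  by (simp add: window_def)

lemma window_add: "window x i (m + n) = window x i m @ window x (i + int m) n"
  by (rule nth_equalityI) (auto simp: nth_append algebra_simps)

lemma window_one [simp]: "window x i (Suc 0) = [x i]"
  by (simp add: window_def)

lemma window_eq_iff: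
  "window x i n = window y j n \<longleftrightarrow> (\<forall>t. 0 \<le> t \<and> t < int n \<longrightarrow> x (i + t) = y (j + t))"
proof -
  have "(\<forall>t. 0 \<le> t \<and> t < int n \<longrightarrow> x (i + t) = y (j + t))
      \<longleftrightarrow> (\<forall>k<n. x (i + int k) = y (j + int k))"
    by (metis nonneg_int_cases of_nat_0_le_iff of_nat_less_iff)
  then show ?thesis by (auto simp: list_eq_iff_nth_eq)
qed

lemma window_same_eq_iff:
  "window x i n = window y i n \<longleftrightarrow> (\<forall>s. i \<le> s \<and> s < i + int n \<longrightarrow> x s = y s)"
  unfolding window_eq_iff by (metis add_diff_cancel_left' add_less_cancel_left diff_add_cancel
      add.commute le_add_same_cancel1)

lemma window_translate: "window (\<lambda>i. x (i + j)) i n = window x (i + j) n"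
  by (simp add: window_def algebra_simps)

lemma shift_space_translate:
  assumes "shift_space A X" "x \<in> X"
  shows "(\<lambda>i. x (i + j)) \<in> X"
proof -
  have X: "shift ` X = X" using assms(1) by (simp add: shift_space_def)
  have pos: "(\<lambda>i. x (i + int n)) \<in> X" for n
  proof (induction n)
    case (Suc n)
    then have "shift (\<lambda>i. x (i + int n)) \<in> X" using X by blast
    then show ?case by (simp add: shift_def algebra_simps)
  qed (simp add: assms)
  have neg: "(\<lambda>i. x (i - int n)) \<in> X" for n
  proof (induction n)
    case (Suc n)
    then obtain y where y: "y \<in> X" "shift y = (\<lambda>i. x (i - int n))" using X by (metis imageE)
    have "y i = x (i - int (Suc n))" for i
      using fun_cong[OF y(2), of "i - 1"] by (simp add: shift_def algebra_simps)
    then have "y = (\<lambda>i. x (i - int (Suc n)))" by (rule ext)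
    with y show ?case by simp
  qed (simp add: assms)
  show ?thesis
    using pos[of "nat j"] neg[of "nat (- j)"] by (cases "j \<ge> 0") simp_all
qed

text \<open>Shift invariance allows the position \<open>i\<close> of the occurrence to be
  prescribed.\<close>

lemma lang_iff:
  assumes "shift_space A X"
  shows "w \<in> lang X \<longleftrightarrow> (\<exists>x\<in>X. window x i (length w) = w)"
proof
  assume "w \<in> lang X"
  then obtain x j where x: "x \<in> X" "w = window x j (length w)" by (auto simp: lang_def)
  with shift_space_translate[OF assms x(1), of "j - i"]
  show "\<exists>x\<in>X. window x i (length w) = w"
    by (intro bexI[of _ "\<lambda>k. x (k + (j - i))"]) (simp_all add: window_translate)
next
  assume "\<exists>x\<in>X. window x i (length w) = w"
  then show "w \<in> lang X" by (auto simp: lang_def) metis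
qed

lemma window_in_lang: "x \<in> X \<Longrightarrow> window x i n \<in> lang X"
  by (auto simp: lang_def)

lemma extendable_language_lang:
  assumes "shift_space A X"
  shows "extendable_language A (lang X)"
proof
  show "finite A" using assms by (simp add: shift_space_def)
  have "X \<subseteq> topspace (product_topology (\<lambda>_::int. discrete_topology A) UNIV)"
    using assms by (intro closedin_subset) (simp add: shift_space_def)
  then have X: "x i \<in> A" if "x \<in> X" for x i
    using that by (auto simp: PiE_iff)
  show "set w \<subseteq> A" if w: "w \<in> lang X" for w
  proof -
    obtain x where "x \<in> X" "window x 0 (length w) = w" using w lang_iff[OF assms] by blast
    with X show ?thesis by (metis (no_types, lifting) imageE list.set_map subsetI window_def)
  qed
  show "w \<in> lang X" if uwv: "u @ w @ v \<in> lang X" for u w v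
  proof -
    obtain x where x: "x \<in> X" "window x 0 (length (u @ w @ v)) = u @ w @ v"
      using uwv lang_iff[OF assms] by blast
    then have "window x (0 + int (length u)) (length w) = w" by (simp add: window_add)
    with window_in_lang[OF x(1)] show ?thesis by metis
  qed
  show "\<exists>b. w @ [b] \<in> lang X" if w: "w \<in> lang X" for w
  proof -
    obtain x where x: "x \<in> X" "window x 0 (length w) = w" using w lang_iff[OF assms] by blast
    have "w @ [x (int (length w))] = window x 0 (length w + 1)"
      using x(2) by (simp add: window_add[of x 0 "length w" 1, simplified])
    with window_in_lang[OF x(1)] show ?thesis by metis
  qed
  show "\<exists>a. a # w \<in> lang X" if w: "w \<in> lang X" for w
  proof -
    obtain x where x: "x \<in> X" "window x 1 (length w) = w" using w lang_iff[OF assms] by blast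
    have "x 0 # w = window x 0 (1 + length w)"
      using x(2) by (simp add: window_add[of x 0 1 "length w", simplified])
    with window_in_lang[OF x(1)] show ?thesis by metis
  qed
qed

section \<open>Tree-shaped extension graphs and double stars\<close>

lemma ext_adj_sym: "ext_adj X w u v \<Longrightarrow> ext_adj X w v u"
  by (auto simp: ext_adj_def)

lemma dendric_language_lang:
  assumes X: "shift_space A X"
    and tree: "\<And>w. w \<in> lang X \<Longrightarrow> length w \<ge> m \<Longrightarrow> is_tree (ext_vertices X w) (ext_adj X w)"
  shows "dendric_language A (lang X) m"
proof -
  interpret extendable_language A "lang X" by (rule extendable_language_lang[OF X])
  show ?thesis
  proof
    fix w assume w: "w \<in> lang X" "length w \<ge> m"
    let ?V = "ext_vertices X w" and ?adj = "ext_adj X w"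
    let ?l = "{a. a # w \<in> lang X}" and ?r = "{b. w @ [b] \<in> lang X}"
    let ?E = "{(a, b). a # w @ [b] \<in> lang X}"
    let ?D = "{(u, v). u \<in> ?V \<and> v \<in> ?V \<and> ?adj u v}"
    have fin: "finite ?l" "finite ?r"
      by (rule finite_subset[OF _ finite_alphabet]; use letters in force)+
    have E: "a \<in> ?l \<and> b \<in> ?r" if "(a, b) \<in> ?E" for a b
      using that prefix_closed[of "a # w" "[b]"] tail_closed[of a "w @ [b]"] by simp
    then have finE: "finite ?E"
      by (intro finite_subset[OF _ finite_cartesian_product[OF fin]]) blast
    have V: "finite ?V" "card ?V = card ?l + card ?r"
      using fin card_Plus[of ?l ?r] by (auto simp: ext_vertices_def Plus_def)
    let ?f = "\<lambda>(a, b). (Inl a, Inr b) :: ('a + 'a) \<times> ('a + 'a)"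
      and ?g = "\<lambda>(a, b). (Inr b, Inl a) :: ('a + 'a) \<times> ('a + 'a)"
    have sub: "?f ` ?E \<union> ?g ` ?E \<subseteq> ?D"
      using E by (auto simp: ext_vertices_def ext_adj_def)
    have "card (?f ` ?E \<union> ?g ` ?E) = card (?f ` ?E) + card (?g ` ?E)"
      using finE by (intro card_Un_disjoint) auto
    also have "\<dots> = 2 * card ?E"
      by (subst (1 2) card_image) (auto simp: inj_on_def)
    finally have "2 * card ?E \<le> card ?D"
      using card_mono[OF _ sub] finite_subset[of ?D "?V \<times> ?V"] V(1) by fastforce
    moreover have "card ?D + 2 \<le> 2 * card ?V"
    proof (rule acyclic_card_edges[OF V(1)])
      show "?V \<noteq> {}" "\<nexists>cs. cycle_in ?V ?adj cs"
        using tree[OF w] by (auto simp: is_tree_def cycle_in_def)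
    qed (auto simp: ext_adj_def)
    ultimately show "card ?E + 1 \<le> card ?l + card ?r" using V(2) by linarith
    have conn: "(u, v) \<in> {(x, y). x \<in> ?V \<and> y \<in> ?V \<and> ?adj x y}\<^sup>*" if "u \<in> ?V" "v \<in> ?V" for u v
      using that tree[OF w] by (auto simp: is_tree_def)
    show "\<exists>a c c'. c \<noteq> c' \<and> a # w @ [c] \<in> lang X \<and> a # w @ [c'] \<in> lang X"
      if "b \<noteq> b'" "w @ [b] \<in> lang X" "w @ [b'] \<in> lang X" for b b'
    proof -
      have "Inr b \<in> ?V" "Inr b' \<in> ?V" using that by (auto simp: ext_vertices_def)
      \<comment> \<open>The path leaves the set formed by \<open>Inr b\<close> and its neighbours.
        The leaving edge cannot start at \<open>Inr b\<close>, so it joins a neighbour of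
        \<open>Inr b\<close> to a second right vertex.\<close>
      then have "\<exists>x y. (x, y) \<in> ?D \<and> x \<in> insert (Inr b) (Inl ` {a. a # w @ [b] \<in> lang X})
          \<and> y \<notin> insert (Inr b) (Inl ` {a. a # w @ [b] \<in> lang X})"
        using \<open>b \<noteq> b'\<close> by (intro rtrancl_crosses_boundary[OF conn[of "Inr b" "Inr b'"]]) auto
      then show ?thesis unfolding ext_adj_def by blast
    qed
    show "\<exists>b c c'. c \<noteq> c' \<and> c # w @ [b] \<in> lang X \<and> c' # w @ [b] \<in> lang X"
      if "a \<noteq> a'" "a # w \<in> lang X" "a' # w \<in> lang X" for a a'
    proof -
      have "Inl a \<in> ?V" "Inl a' \<in> ?V" using that by (auto simp: ext_vertices_def)
      then have "\<exists>x y. (x, y) \<in> ?D \<and> x \<in> insert (Inl a) (Inr ` {b. a # w @ [b] \<in> lang X})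
          \<and> y \<notin> insert (Inl a) (Inr ` {b. a # w @ [b] \<in> lang X})"
        using \<open>a \<noteq> a'\<close> by (intro rtrancl_crosses_boundary[OF conn[of "Inl a" "Inl a'"]]) auto
      then show ?thesis unfolding ext_adj_def by blast
    qed
  qed
qed

text \<open>All left vertices are joined to \<open>b\<close> and all right vertices to
  \<open>a\<close>, which gives connectedness. A vertex other than these two hubs has only one
  neighbour, so a cycle would have at most two vertices.\<close>

lemma double_star_is_tree:
  assumes X: "shift_space A X" and star: "double_star (biext (lang X) 1 w)"
  shows "is_tree (ext_vertices X w) (ext_adj X w)"
proof -
  interpret extendable_language A "lang X" by (rule extendable_language_lang[OF X])
  let ?V = "ext_vertices X w" and ?adj = "ext_adj X w"
  let ?R = "{(x, y). x \<in> ?V \<and> y \<in> ?V \<and> ?adj x y}"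
  obtain u z where uz: "(u, z) \<in> biext (lang X) 1 w"
    and uz_all: "\<And>c d. (c, d) \<in> biext (lang X) 1 w \<Longrightarrow> c = u \<or> d = z"
    using star unfolding double_star_def by blast
  from uz obtain a b where ab: "u = [a]" "z = [b]"
    by (auto simp: biext_def length_Suc_conv)
  have edge: "a # w @ [b] \<in> lang X" using uz ab by (simp add: biext_def)
  have hub: "c = a \<or> d = b" if "c # w @ [d] \<in> lang X" for c d
    using uz_all[of "[c]" "[d]"] that ab by (simp add: biext_def)
  have left: "c # w @ [b] \<in> lang X" if c: "c # w \<in> lang X" for c
    using extend_right[OF c] hub edge by (metis append_Cons)
  have right: "a # w @ [d] \<in> lang X" if d: "w @ [d] \<in> lang X" for d
    using extend_left[OF d] hub edge by metis
  have V: "Inl a \<in> ?V" "Inr b \<in> ?V"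
    using edge prefix_closed[of "a # w" "[b]"] tail_closed[of a "w @ [b]"]
    by (auto simp: ext_vertices_def)
  have ab_R: "(Inl a, Inr b) \<in> ?R" "(Inr b, Inl a) \<in> ?R"
    using V edge by (auto simp: ext_adj_def)
  have reach: "(Inl a, v) \<in> ?R\<^sup>* \<and> (v, Inl a) \<in> ?R\<^sup>*" if v: "v \<in> ?V" for v
  proof (cases v)
    case (Inl c)
    then have "c # w @ [b] \<in> lang X" using v left by (auto simp: ext_vertices_def)
    then have "(v, Inr b) \<in> ?R" "(Inr b, v) \<in> ?R" using v V Inl by (auto simp: ext_adj_def)
    with ab_R show ?thesis by (meson converse_rtrancl_into_rtrancl r_into_rtrancl)
  next
    case (Inr d)
    then have "a # w @ [d] \<in> lang X" using v right by (auto simp: ext_vertices_def)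
    then have "(v, Inl a) \<in> ?R" "(Inl a, v) \<in> ?R" using v V Inr by (auto simp: ext_adj_def)
    then show ?thesis by blast
  qed
  have "\<not> cycle_in ?V ?adj cs" for cs
  proof
    assume cyc: "cycle_in ?V ?adj cs"
    have "c \<in> {Inl a, Inr b}" if "c \<in> set cs" for c
    proof -
      from cycle_in_two_neighbours[OF cyc that ext_adj_sym]
      obtain d e where "d \<noteq> e" "?adj c d" "?adj c e" by blast
      then show ?thesis using hub unfolding ext_adj_def by blast
    qed
    then have "card (set cs) \<le> card {Inl a, Inr b :: 'a + 'a}" by (intro card_mono) auto
    also have "\<dots> = 2" by simp
    finally show False using cyc by (simp add: cycle_in_def distinct_card)
  qed
  moreover have "(u, v) \<in> ?R\<^sup>*" if "u \<in> ?V" "v \<in> ?V" for u v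
    using reach[OF that(1)] reach[OF that(2)] by (meson rtrancl_trans)
  ultimately show ?thesis using V(1) unfolding is_tree_def cycle_in_def by blast
qed

section \<open>Conjugacies\<close>

text \<open>Both maps are indexed by points of \<open>X\<close>, so one predicate expresses that
  \<phi> is a local code and that its inverse is one. Independent positions \<open>i\<close> and
  \<open>j\<close> make the local rule the same everywhere.\<close>

definition determined_by ::
  "'p set \<Rightarrow> nat \<Rightarrow> ('p \<Rightarrow> int \<Rightarrow> 'c) \<Rightarrow> ('p \<Rightarrow> int \<Rightarrow> 'd) \<Rightarrow> bool" where
  "determined_by X k g h \<longleftrightarrow> (\<forall>x\<in>X. \<forall>y\<in>X. \<forall>i j.
     (\<forall>t. \<bar>t\<bar> \<le> int k \<longrightarrow> g x (i + t) = g y (j + t)) \<longrightarrow> h x i = h y j)"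

lemma determined_by_mono:
  "determined_by X k g h \<Longrightarrow> k \<le> l \<Longrightarrow> determined_by X l g h"
  unfolding determined_by_def by (meson of_nat_le_iff order_trans)

lemma determined_byD:
  assumes "determined_by X k g h" "x \<in> X" "y \<in> X"
    and "\<And>s. i - int k \<le> s \<Longrightarrow> s \<le> i + int k \<Longrightarrow> g x s = g y s"
  shows "h x i = h y i"
proof -
  have "g x (i + t) = g y (i + t)" if "\<bar>t\<bar> \<le> int k" for t
    using that by (intro assms(4)) auto
  then show ?thesis using assms(1-3) unfolding determined_by_def by blast
qed

text \<open>The set is a finite union of products of cylinders, and cylinders are closed because
  coordinate projections into the discrete alphabet are continuous.\<close>

lemma closedin_window_pairs:
  fixes X :: "(int \<Rightarrow> 'a) set"
  defines "T \<equiv> \<lambda>A :: 'a set. product_topology (\<lambda>_::int. discrete_topology A) UNIV"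
  assumes X: "shift_space A X"
  shows "closedin (prod_topology (T A) (T A))
     {(x, y). x \<in> X \<and> y \<in> X \<and> P (window x i n) (window y i n)}"
proof -
  interpret extendable_language A "lang X" by (rule extendable_language_lang[OF X])
  have cX: "closedin (T A) X" using X by (simp add: shift_space_def T_def)
  define C where "C w = {x \<in> X. window x i n = w}" for w
  have cC: "closedin (T A) (C w)" if w: "w \<in> words n" for w
  proof -
    have "C w = X \<inter> (\<Inter>k\<in>{..<n}. {x \<in> topspace (T A). x (i + int k) \<in> {w ! k}}) "
      if "n \<noteq> 0"
      using w closedin_subset[OF cX] that by (auto simp: C_def words_def list_eq_iff_nth_eq)
    moreover have "closedin (T A) {x \<in> topspace (T A). x (i + int k) \<in> {w ! k}}" if "k < n" for k
    proof (rule closedin_continuous_map_preimage)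
      show "continuous_map (T A) (discrete_topology A) (\<lambda>x. x (i + int k))"
        unfolding T_def by (rule continuous_map_product_projection) simp
      show "closedin (discrete_topology A) {w ! k}"
        using w letters[of w] that by (auto simp: words_def)
    qed
    moreover have "C w = X" if "n = 0" using that w by (auto simp: C_def words_def window_def)
    ultimately show ?thesis
      using cX by (cases "n = 0") (auto intro!: closedin_Int closedin_INT)
  qed
  let ?S = "{(v, w). v \<in> words n \<and> w \<in> words n \<and> P v w}"
  have "{(x, y). x \<in> X \<and> y \<in> X \<and> P (window x i n) (window y i n)} = (\<Union>(v, w)\<in>?S. C v \<times> C w)"
    by (auto simp: C_def words_def window_in_lang)
  moreover have "finite ?S"
    by (rule finite_subset[of _ "words n \<times> words n"]) (auto simp: finite_words)
  ultimately show ?thesis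
    using cC by (auto intro!: closedin_Union simp: closedin_prod_Times_iff)
qed

text \<open>Compactness: the pairs that differ at 0 while their images agree on
  \<open>{- int k..int k}\<close> form decreasing closed sets \<open>C k\<close>. Injectivity makes
  their intersection empty, so some \<open>C k\<close> is empty, and this \<open>k\<close> is a
  radius for the inverse.\<close>

lemma inverse_radius:
  assumes X: "shift_space A X" and inj: "inj_on \<phi> X"
    and code: "\<And>x i. x \<in> X \<Longrightarrow> \<phi> x i = f (window x (i - int m) (m + n + 1))"
  obtains k where "determined_by X k \<phi> (\<lambda>x. x)"
proof -
  let ?T = "product_topology (\<lambda>_::int. discrete_topology A) UNIV"
  define D where "D i = {(x, y). x \<in> X \<and> y \<in> X \<and> \<phi> x i = \<phi> y i}" for i
  define D0 where "D0 = {(x, y). x \<in> X \<and> y \<in> X \<and> x 0 \<noteq> y 0}"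
  define C where "C k = D0 \<inter> (\<Inter>i\<in>{- int k..int k}. D i)" for k :: nat
  have "D i = {(x, y). x \<in> X \<and> y \<in> X \<and>
      f (window x (i - int m) (m + n + 1)) = f (window y (i - int m) (m + n + 1))}" for i
    unfolding D_def using code by fastforce
  then have "closedin (prod_topology ?T ?T) (D i)" for i
    using closedin_window_pairs[OF X, of "\<lambda>v w. f v = f w"] by presburger
  moreover have "closedin (prod_topology ?T ?T) D0"
    using closedin_window_pairs[OF X, of "(\<noteq>)" 0 1] by (simp add: D0_def)
  ultimately have clo: "closedin (prod_topology ?T ?T) (C k)" for k
    unfolding C_def by (intro closedin_Int closedin_INT) auto
  have dec: "decseq C"
    unfolding decseq_def C_def by fastforce
  have "compact_space (prod_topology ?T ?T)"
    using X by (simp add: shift_space_def compact_space_prod_topology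
        compact_space_product_topology compact_space_discrete_topology)
  have "(\<Inter>k. C k) = {}"
  proof (rule ccontr)
    assume "(\<Inter>k. C k) \<noteq> {}"
    then obtain x y where xy: "\<And>k. (x, y) \<in> C k" by auto
    have "\<phi> x i = \<phi> y i" for i
      using xy[of "nat \<bar>i\<bar>"] abs_le_iff[of i "\<bar>i\<bar>"] by (auto simp: C_def D_def)
    moreover have "x \<in> X" "y \<in> X" "x 0 \<noteq> y 0" using xy[of 0] by (auto simp: C_def D0_def)
    ultimately show False using inj by (metis ext inj_onD)
  qed
  with compact_space_imp_nest[OF \<open>compact_space _\<close> clo _ dec]
  obtain k where k: "C k = {}" by blast
  have "determined_by X k \<phi> (\<lambda>x. x)"
    unfolding determined_by_def
  proof (intro ballI allI impI)
    fix x y i j assume xy: "x \<in> X" "y \<in> X"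
      and eq: "\<forall>t. \<bar>t\<bar> \<le> int k \<longrightarrow> \<phi> x (i + t) = \<phi> y (j + t)"
    \<comment> \<open>\<open>C k\<close> only compares points at position 0, so \<open>i\<close> and
      \<open>j\<close> are translated there.\<close>
    let ?x = "\<lambda>s. x (s + i)" and ?y = "\<lambda>s. y (s + j)"
    have X': "?x \<in> X" "?y \<in> X" using shift_space_translate[OF X] xy by blast+
    have "\<phi> ?x t = \<phi> ?y t" if "\<bar>t\<bar> \<le> int k" for t
    proof -
      have "\<phi> ?x t = \<phi> x (i + t)" "\<phi> ?y t = \<phi> y (j + t)"
        using code[OF X'(1)] code[OF X'(2)] code[OF xy(1)] code[OF xy(2)]
        by (simp_all add: window_translate algebra_simps)
      with eq that show ?thesis by simp
    qed
    then have "(?x, ?y) \<in> D t" if "t \<in> {- int k..int k}" for t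
      using that X' by (auto simp: D_def)
    moreover have "(?x, ?y) \<notin> C k" using k by simp
    ultimately show "x i = y j" using X' by (auto simp: C_def D0_def)
  qed
  with that show thesis by blast
qed

lemma conjugate_radius:
  assumes X: "shift_space A X" and "conjugate X Y"
  obtains \<phi> k where "\<phi> ` X = Y" "determined_by X k (\<lambda>x. x) \<phi>" "determined_by X k \<phi> (\<lambda>x. x)"
proof -
  from assms(2) obtain \<phi> m n f where bij: "bij_betw \<phi> X Y"
    and code: "\<And>x i. x \<in> X \<Longrightarrow> \<phi> x i = f (window x (i - int m) (m + n + 1))"
    unfolding conjugate_def sliding_block_code_def by blast
  obtain k where k: "determined_by X k \<phi> (\<lambda>x. x)"
    using inverse_radius[of A X \<phi> f m n] X bij code by (metis bij_betw_def)
  have "determined_by X (max m n) (\<lambda>x. x) \<phi>"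
    unfolding determined_by_def
  proof (intro ballI allI impI)
    fix x y i j assume xy: "x \<in> X" "y \<in> X"
      and eq: "\<forall>t. \<bar>t\<bar> \<le> int (max m n) \<longrightarrow> x (i + t) = y (j + t)"
    have "x (i - int m + t) = y (j - int m + t)" if "0 \<le> t \<and> t < int (m + n + 1)" for t
      using eq[rule_format, of "t - int m"] that by (auto simp: algebra_simps)
    then have "window x (i - int m) (m + n + 1) = window y (j - int m) (m + n + 1)"
      unfolding window_eq_iff by blast
    then show "\<phi> x i = \<phi> y j" by (simp add: code xy)
  qed
  with k bij that[of \<phi> "max k (max m n)"] show thesis
    by (metis bij_betw_imp_surj_on determined_by_mono max.cobounded1 max.cobounded2)
qed

text \<open>A word \<open>v\<close> of \<open>Y\<close> determines a word \<open>w\<close> of \<open>X\<close> that is shorter by the radius \<open>k\<close> at each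
  end. The extension graph of \<open>v\<close> is the image of the subgraph of \<open>biext (lang X) (2 * k + 1) w\<close>
  induced by those left and right extensions of \<open>w\<close> that are compatible with \<open>v\<close>.\<close>

lemma double_star_transfer:
  assumes X: "shift_space A X" and Y: "shift_space B Y" and im: "\<phi> ` X = Y"
    and det: "determined_by X k (\<lambda>x. x) \<phi>" and inv: "determined_by X k \<phi> (\<lambda>x. x)"
    and star: "\<And>w. w \<in> lang X \<Longrightarrow> length w \<ge> N \<Longrightarrow> double_star (biext (lang X) (2 * k + 1) w)"
    and v: "v \<in> lang Y" "length v \<ge> N + 4 * k"
  shows "double_star (biext (lang Y) 1 v)"
proof -
  define n where "n = length v"
  have n: "n \<ge> N + 4 * k" using v(2) by (simp add: n_def)
  define M where "M x \<longleftrightarrow> x \<in> X \<and> window (\<phi> x) 0 n = v" for x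
  \<comment> \<open>The word \<open>v\<close> occupies positions 0 to \<open>n - 1\<close> of the
    image. The windows \<open>lf\<close>, \<open>mid\<close>, \<open>rt\<close> are consecutive:
    \<open>mid\<close> is determined by \<open>v\<close> through the inverse, while
    \<open>lf\<close> and \<open>rt\<close> are centred at \<open>- 1\<close> and \<open>n\<close>
    with radius \<open>k\<close> and so determine the letters of the image next to
    \<open>v\<close>.\<close>
  define mid where "mid x = window x (int k) (n - 2 * k)" for x :: "int \<Rightarrow> 'a"
  define lf where "lf x = window x (- int k - 1) (2 * k + 1)" for x :: "int \<Rightarrow> 'a"
  define rt where "rt x = window x (int n - int k) (2 * k + 1)" for x :: "int \<Rightarrow> 'a"
  obtain x0 where x0: "M x0"
    using v(1) lang_iff[OF Y, of v 0] im by (auto simp: M_def n_def)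
  define w where "w = mid x0"
  have mid: "mid x = w" if "M x" for x
  proof -
    have "x s = x0 s" if "int k \<le> s" "s < int n - int k" for s
      using that \<open>M x\<close> x0 window_same_eq_iff[of "\<phi> x" 0 n "\<phi> x0"]
      by (intro determined_byD[OF inv]) (auto simp: M_def)
    then show ?thesis
      unfolding w_def mid_def window_same_eq_iff using n by auto
  qed
  have w: "w \<in> lang X" "length w \<ge> N"
    using x0 n by (auto simp: w_def mid_def M_def window_in_lang)
  have split: "window x (- int k - 1) (2 * k + 1 + (length w + (2 * k + 1))) = lf x @ mid x @ rt x"
    for x
    unfolding window_add lf_def mid_def rt_def w_def using n by (simp add: of_nat_diff algebra_simps)
  have edge: "(lf x, rt x) \<in> biext (lang X) (2 * k + 1) w" if "M x" for x
    using window_in_lang[of x X "- int k - 1" "2 * k + 1 + (length w + (2 * k + 1))"] that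
    unfolding split mid[OF that] by (auto simp: M_def biext_def lf_def rt_def)
  obtain p where p: "p \<in> biext (lang X) (2 * k + 1) w"
    and p_all: "\<And>c d. (c, d) \<in> biext (lang X) (2 * k + 1) w \<Longrightarrow> c = fst p \<or> d = snd p"
    using star[OF w] unfolding double_star_def by fastforce
  have "fst p @ w @ snd p \<in> lang X" and len: "length (fst p) = 2 * k + 1" "length (snd p) = 2 * k + 1"
    using p by (auto simp: biext_def)
  \<comment> \<open>The point \<open>xp\<close> realises the hub edge \<open>p\<close>, but its
    image need not show \<open>v\<close>.\<close>
  then obtain xp where xp: "xp \<in> X"
      "window xp (- int k - 1) (2 * k + 1 + (length w + (2 * k + 1))) = fst p @ w @ snd p"
    using lang_iff[OF X, of "fst p @ w @ snd p" "- int k - 1"] by auto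
  have p_lf: "lf xp = fst p" and p_mid: "mid xp = w" and p_rt: "rt xp = snd p"
    using xp(2) len unfolding split by (auto simp: lf_def mid_def rt_def w_def)
  have lf_eq: "\<phi> x (- 1) = \<phi> y (- 1)" if "x \<in> X" "y \<in> X" "lf x = lf y" for x y
    using that unfolding lf_def window_same_eq_iff by (intro determined_byD[OF det]) auto
  have rt_eq: "\<phi> x (int n) = \<phi> y (int n)" if "x \<in> X" "y \<in> X" "rt x = rt y" for x y
    using that unfolding rt_def window_same_eq_iff by (intro determined_byD[OF det]) auto
  \<comment> \<open>If each half of \<open>p\<close> occurs in a point whose image shows
    \<open>v\<close>, then the image of \<open>xp\<close> shows \<open>v\<close> too, since
    \<open>xp\<close> agrees with \<open>x\<close> up to the end of \<open>mid\<close> and with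
    \<open>y\<close> from its start.\<close>
  have glue: "M xp" if x: "M x" "lf x = fst p" and y: "M y" "rt y = snd p" for x y
  proof -
    have xs: "xp s = x s" if "- int k - 1 \<le> s" "s < int n - int k" for s
    proof (cases "s < int k")
      case True
      then show ?thesis using that p_lf x(2) window_same_eq_iff[of xp "- int k - 1" "2 * k + 1" x]
        by (simp add: lf_def)
    next
      case False
      then show ?thesis using that n p_mid mid[OF x(1)] window_same_eq_iff[of xp "int k" "n - 2 * k" x]
        by (simp add: mid_def of_nat_diff)
    qed
    have ys: "xp s = y s" if "int k \<le> s" "s \<le> int n + int k" for s
    proof (cases "s < int n - int k")
      case True
      then show ?thesis using that n p_mid mid[OF y(1)] window_same_eq_iff[of xp "int k" "n - 2 * k" y]
        by (simp add: mid_def of_nat_diff)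
    next
      case False
      then show ?thesis
        using that p_rt y(2) window_same_eq_iff[of xp "int n - int k" "2 * k + 1" y]
        by (simp add: rt_def)
    qed
    \<comment> \<open>For \<open>s < 2 * k\<close> the positions read end before
      \<open>3 * k \<le> n - k\<close>, where \<open>xp\<close> agrees with \<open>x\<close>;
      otherwise they start at \<open>k\<close> or later, where it agrees with \<open>y\<close>. The
      bound \<open>n \<ge> 4 * k\<close> enters here.\<close>
    have "\<phi> xp s = \<phi> x0 s" if s: "0 \<le> s" "s < int n" for s
    proof (cases "s < 2 * int k")
      case True
      have "\<phi> xp s = \<phi> x s"
        by (rule determined_byD[OF det xp(1)]) (use x(1) xs True s n in \<open>auto simp: M_def\<close>)
      also have "\<dots> = \<phi> x0 s"
        using x(1) x0 s window_same_eq_iff[of "\<phi> x" 0 n "\<phi> x0"] by (simp add: M_def)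
      finally show ?thesis .
    next
      case False
      have "\<phi> xp s = \<phi> y s"
        by (rule determined_byD[OF det xp(1)]) (use y(1) ys False s n in \<open>auto simp: M_def\<close>)
      also have "\<dots> = \<phi> x0 s"
        using y(1) x0 s window_same_eq_iff[of "\<phi> y" 0 n "\<phi> x0"] by (simp add: M_def)
      finally show ?thesis .
    qed
    then have "window (\<phi> xp) 0 n = window (\<phi> x0) 0 n" by (simp add: window_same_eq_iff)
    with x0 xp(1) show ?thesis by (simp add: M_def)
  qed
  define e where "e x = ([\<phi> x (- 1)], [\<phi> x (int n)])" for x
  have window_Y: "window y (- 1) (n + 2) = y (- 1) # window y 0 n @ [y (int n)]" for y :: "int \<Rightarrow> 'b"
    using window_add[of y "- 1" 1 "n + 1"] window_add[of y 0 n 1] by simp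
  have biext_Y: "biext (lang Y) 1 v = e ` {x. M x}"
  proof (intro equalityI subsetI)
    fix q assume "q \<in> biext (lang Y) 1 v"
    then obtain a b where q: "q = ([a], [b])" "a # v @ [b] \<in> lang Y"
      by (auto simp: biext_def length_Suc_conv)
    then obtain y where y: "y \<in> Y" "window y (- 1) (n + 2) = a # v @ [b]"
      using lang_iff[OF Y, of "a # v @ [b]" "- 1"] by (auto simp: n_def)
    then obtain x where "x \<in> X" "y = \<phi> x" using im by blast
    with y(2)[unfolded window_Y] have "M x" "e x = q"
      using q(1) by (auto simp: M_def e_def n_def)
    then show "q \<in> e ` {x. M x}" by blast
  next
    fix q assume "q \<in> e ` {x. M x}"
    then obtain x where x: "M x" "q = e x" by blast
    then have "window (\<phi> x) (- 1) (n + 2) \<in> lang Y" using im by (auto simp: M_def window_in_lang)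
    with x show "q \<in> biext (lang Y) 1 v" unfolding window_Y by (simp add: biext_def e_def M_def)
  qed
  have meets: "fst (e x) = fst (e y) \<or> snd (e x) = snd (e y)"
    if "M x" "M y" "lf x = lf y \<or> rt x = rt y" for x y
    using that lf_eq[of x y] rt_eq[of x y] by (auto simp: e_def M_def)
  \<comment> \<open>If \<open>xp\<close> itself is excluded, \<open>glue\<close> shows that one half
    of \<open>p\<close> never occurs. All points of \<open>M\<close> then share the other half, so
    \<open>x0\<close> serves as centre.\<close>
  have "\<exists>c. M c \<and> (\<forall>x. M x \<longrightarrow> lf x = lf c \<or> rt x = rt c)"
  proof (cases "M xp")
    case True
    then show ?thesis using p_all edge p_lf p_rt by metis
  next
    case False
    then show ?thesis using p_all edge glue x0 by metis
  qed
  then obtain c where "M c" "\<And>x. M x \<Longrightarrow> fst (e x) = fst (e c) \<or> snd (e x) = snd (e c)"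
    using meets by blast
  then show ?thesis
    unfolding biext_Y double_star_def by (intro bexI[of _ "e c"]) (auto simp: case_prod_beta)
qed

theorem mainTheorem10:
  fixes A :: "'a set" and B :: "'b set"
    and X :: "(int \<Rightarrow> 'a) set" and Y :: "(int \<Rightarrow> 'b) set"
  assumes "shift_space A X"
    and "shift_space B Y"
    and "eventually_dendric X"
    and "conjugate X Y"
  shows "eventually_dendric Y"
proof -
  obtain \<phi> k where \<phi>: "\<phi> ` X = Y" "determined_by X k (\<lambda>x. x) \<phi>" "determined_by X k \<phi> (\<lambda>x. x)"
    using conjugate_radius[OF assms(1,4)] by blast
  obtain m where "\<And>w. w \<in> lang X \<Longrightarrow> length w \<ge> m \<Longrightarrow> is_tree (ext_vertices X w) (ext_adj X w)"
    using assms(3) by (auto simp: eventually_dendric_def)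
  then interpret dendric_language A "lang X" m
    by (rule dendric_language_lang[OF assms(1)])
  obtain N where "\<And>w. w \<in> lang X \<Longrightarrow> length w \<ge> N \<Longrightarrow> double_star (biext (lang X) (2 * k + 1) w)"
    using eventually_double_star by blast
  then have "is_tree (ext_vertices Y v) (ext_adj Y v)"
    if "v \<in> lang Y" "length v \<ge> N + 4 * k" for v
    using that by (intro double_star_is_tree[OF assms(2)]
        double_star_transfer[OF assms(1,2) \<phi>, of N])
  then show ?thesis unfolding eventually_dendric_def by blast
qed

end
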